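(* Let $F:\mathbb{R}^d\to\mathbb{R}^d$ be $L$-Lipschitz with $F(x_* )=0$. Suppose that the extrapolation step sizes $\gamma_k>0$ of PolyakEG are chosen so that the critical condition $$\|F(\hat x_k)-F(x_k)\|\le A\|F(x_k)\|,\qquad \hat x_k=x_k-\gamma_kF(x_k),$$ holds for all $k\ge0$. Then PolyakEG satisfies the following. (1) If $F$ is monotone and $A\in(0,1]$, then for every $K\ge0$ $$\min_{k=0,\dots,K}\gamma_k^2\|F(\hat x_k)\|^2\le\frac{(1+A)^2\|x_0-x_*\|^2}{K+1}.$$ If moreover $A\in(0,1)$, then additionally $$\min_{k=0,\dots,K}\gamma_k^2\|F(x_k)\|^2\le\frac{(1+A)\|x_0-x_*\|^2}{(1-A)(K+1)}.$$ (2) If $F$ is $\mu$-strongly monotone and $A\in(0,1)$, then for every $k\ge0$ $$\|x_{k+1}-x_*\|^2\le\prod_{j=0}^k\left(1-\frac{2(1-A)\gamma_j\mu}{(1+A)^2}\right)\|x_0-x_*\|^2.$$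
   Context: PolyakEG: given $x_0\in\mathbb{R}^d$ and a positive sequence $\{\gamma_k\}_{k\ge0}$, for $k=0,1,\dots$ $$\hat x_k=x_k-\gamma_kF(x_k),\qquad \omega_k=\frac{\langle F(\hat x_k),x_k-\hat x_k\rangle}{\|F(\hat x_k)\|^2},\qquad x_{k+1}=x_k-\omega_kF(\hat x_k),$$ where $F(\hat x_k)\ne0$ is assumed at the iterations considered, so that $\omega_k$ is well defined. Monotone: $\langle F(x)-F(y),x-y\rangle\ge0$ for all $x,y$. $\mu$-strongly monotone ($\mu>0$): $\langle F(x)-F(y),x-y\rangle\ge\mu\|x-y\|^2$ for all $x,y$. *)

theory Defs
  imports "HOL-Analysis.Analysis"
begin

definition monotone_operator :: "('a::real_inner \<Rightarrow> 'a) \<Rightarrow> bool" where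
  "monotone_operator F \<longleftrightarrow> (\<forall>x y. (F x - F y) \<bullet> (x - y) \<ge> 0)"

definition strongly_monotone_operator :: "real \<Rightarrow> ('a::real_inner \<Rightarrow> 'a) \<Rightarrow> bool" where
  "strongly_monotone_operator \<mu> F \<longleftrightarrow>
     \<mu> > 0 \<and> (\<forall>x y. (F x - F y) \<bullet> (x - y) \<ge> \<mu> * (norm (x - y))\<^sup>2)"

definition extrapolate :: "('a::real_inner \<Rightarrow> 'a) \<Rightarrow> real \<Rightarrow> 'a \<Rightarrow> 'a" where
  "extrapolate F g x = x - g *\<^sub>R F x"

(* Meaningful only when F xh is nonzero; otherwise division by zero makes it 0,
   so that the iteration below stays where it is. *)
definition polyak_stepsize :: "('a::real_inner \<Rightarrow> 'a) \<Rightarrow> 'a \<Rightarrow> 'a \<Rightarrow> real" where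
  "polyak_stepsize F x xh = (F xh \<bullet> (x - xh)) / (norm (F xh))\<^sup>2"

primrec polyak_eg :: "('a::real_inner \<Rightarrow> 'a) \<Rightarrow> (nat \<Rightarrow> real) \<Rightarrow> 'a \<Rightarrow> nat \<Rightarrow> 'a" where
  "polyak_eg F \<gamma> x0 0 = x0"
| "polyak_eg F \<gamma> x0 (Suc k) =
     (let x = polyak_eg F \<gamma> x0 k; xh = extrapolate F (\<gamma> k) x
      in x - polyak_stepsize F x xh *\<^sub>R F xh)"

definition polyak_eg_hat :: "('a::real_inner \<Rightarrow> 'a) \<Rightarrow> (nat \<Rightarrow> real) \<Rightarrow> 'a \<Rightarrow> nat \<Rightarrow> 'a" where
  "polyak_eg_hat F \<gamma> x0 k = extrapolate F (\<gamma> k) (polyak_eg F \<gamma> x0 k)"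

end

theory Submission
  imports Defs
begin

text \<open>
  Write \<open>a = F x\<close>, \<open>b = F xh\<close> and \<open>x - xh = g *\<^sub>R a\<close> for one iteration. The Polyak step size
  \<open>\<omega>\<close> satisfies \<open>\<omega> * (norm b)\<^sup>2 = b \<bullet> (x - xh)\<close>; geometrically, the next iterate is the
  projection of \<open>x\<close> onto the hyperplane through \<open>xh\<close> with normal \<open>b\<close>. Hence the squared
  distance to a solution \<open>z\<close> changes by exactly
  \<open>- 2 * \<omega> * (b \<bullet> (xh - z)) - \<omega>\<^sup>2 * (norm b)\<^sup>2\<close> (\<open>polyak_step_distance\<close>), where
  monotonicity bounds \<open>b \<bullet> (xh - z)\<close> from below.

  The critical condition says that \<open>b\<close> lies in a ball of radius \<open>A * norm a\<close> about \<open>a\<close>.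
  Squaring it gives \<open>2 * (a \<bullet> b) \<ge> (norm b)\<^sup>2 + (1 - A\<^sup>2) * (norm a)\<^sup>2\<close>. Together with
  \<open>norm b \<le> (1 + A) * norm a\<close> this yields \<open>\<omega> \<ge> g / (1 + A)\<close> and, by the arithmetic-geometric
  mean inequality, \<open>(\<omega> * norm b)\<^sup>2 \<ge> (1 - A\<^sup>2) * (g * norm a)\<^sup>2\<close>.

  For monotone \<open>F\<close> both rates follow by telescoping, since the decrease of the squared
  distance is at least \<open>(\<omega> * norm b)\<^sup>2\<close>, which dominates a positive multiple of \<open>(g * norm b)\<^sup>2\<close>
  and, if \<open>A < 1\<close>, of \<open>(g * norm a)\<^sup>2\<close>.

  For strongly monotone \<open>F\<close> the decrease is at least
  \<open>2 * \<mu> * g / (1 + A) * (norm (xh - z))\<^sup>2 + (1 - A\<^sup>2) * (g * norm a)\<^sup>2\<close>, and a weighted Young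
  inequality for \<open>x - z = (xh - z) + g *\<^sub>R a\<close> turns this into a multiple of \<open>(norm (x - z))\<^sup>2\<close>.
  The second term is large enough for this because strong monotonicity together with the
  critical condition forces \<open>g * \<mu> \<le> A\<close> (\<open>critical_step_bound\<close>).
\<close>

section \<open>Consequences of the critical condition\<close>

lemma critical_inner:
  fixes a b :: "'a::real_inner"
  assumes "norm (b - a) \<le> A * norm a"
  shows "(norm b)\<^sup>2 + (1 - A\<^sup>2) * (norm a)\<^sup>2 \<le> 2 * (a \<bullet> b)"
proof -
  have "(norm (b - a))\<^sup>2 \<le> (A * norm a)\<^sup>2"
    using assms by (intro power_mono) auto
  then show ?thesis
    by (simp add: power2_norm_eq_inner inner_diff power_mult_distrib inner_commute algebra_simps)
qed

text \<open>
  This is \<open>critical_inner\<close> with \<open>norm a\<close> eliminated by the triangle inequality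
  \<open>norm b \<le> (1 + A) * norm a\<close>.
\<close>
lemma critical_inner_ge_norm_sq:
  fixes a b :: "'a::real_inner"
  assumes crit: "norm (b - a) \<le> A * norm a" and A: "0 \<le> A" "A \<le> 1"
  shows "(norm b)\<^sup>2 \<le> (1 + A) * (a \<bullet> b)"
proof -
  have "norm b \<le> (1 + A) * norm a"
    using norm_triangle_ineq[of "b - a" a] crit by (simp add: algebra_simps)
  then have "(norm b)\<^sup>2 \<le> ((1 + A) * norm a)\<^sup>2"
    by (intro power_mono) auto
  then have "(1 - A) * (norm b)\<^sup>2 \<le> (1 - A) * ((1 + A) * norm a)\<^sup>2"
    using A by (intro mult_left_mono) auto
  moreover have "(1 + A) * ((norm b)\<^sup>2 + (1 - A\<^sup>2) * (norm a)\<^sup>2) \<le> (1 + A) * (2 * (a \<bullet> b))"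
    using critical_inner[OF crit] A by (intro mult_left_mono) auto
  ultimately show ?thesis
    by (simp add: power2_eq_square algebra_simps)
qed

text \<open>
  Geometrically, the angle between \<open>a\<close> and \<open>b\<close> is at most \<open>arcsin A\<close>, as \<open>b\<close> lies in a ball
  of radius \<open>A * norm a\<close> about \<open>a\<close>.
\<close>
lemma critical_inner_sq_ge:
  fixes a b :: "'a::real_inner"
  assumes crit: "norm (b - a) \<le> A * norm a" and A: "0 \<le> A" "A \<le> 1"
  shows "(1 - A\<^sup>2) * (norm a)\<^sup>2 * (norm b)\<^sup>2 \<le> (a \<bullet> b)\<^sup>2"
proof -
  define p q where "p = (norm b)\<^sup>2" and "q = (1 - A\<^sup>2) * (norm a)\<^sup>2"
  have "A\<^sup>2 \<le> 1"
    using A by (simp add: power_le_one)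
  then have pos: "0 \<le> p" "0 \<le> q"
    by (auto simp: p_def q_def)
  have "4 * (q * p) \<le> (p + q)\<^sup>2"
    using zero_le_power2[of "p - q"] by (simp add: power2_eq_square algebra_simps)
  also have "\<dots> \<le> (2 * (a \<bullet> b))\<^sup>2"
    using critical_inner[OF crit] pos by (intro power_mono) (auto simp: p_def q_def)
  finally show ?thesis
    by (simp add: p_def q_def power_mult_distrib)
qed

text \<open>
  Strong monotonicity makes \<open>F\<close> expand distances by at least \<open>\<mu>\<close>, while the critical condition
  caps the variation of \<open>F\<close> over the extrapolation step.
\<close>
lemma critical_step_bound:
  fixes F :: "'a::real_inner \<Rightarrow> 'a"
  assumes sm: "strongly_monotone_operator \<mu> F" and g: "0 < g" and nz: "F x \<noteq> 0"
    and crit: "norm (F (extrapolate F g x) - F x) \<le> A * norm (F x)"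
  shows "g * \<mu> \<le> A"
proof -
  define xh where "xh = extrapolate F g x"
  have d: "xh - x = - (g *\<^sub>R F x)"
    by (simp add: xh_def extrapolate_def)
  have "\<mu> * (g * norm (F x))\<^sup>2 = \<mu> * (norm (xh - x))\<^sup>2"
    using g by (simp add: d)
  also have "\<dots> \<le> (F xh - F x) \<bullet> (xh - x)"
    using sm by (auto simp: strongly_monotone_operator_def)
  also have "\<dots> \<le> norm (F xh - F x) * norm (xh - x)"
    by (rule norm_cauchy_schwarz)
  also have "\<dots> \<le> (A * norm (F x)) * (g * norm (F x))"
    using mult_right_mono[OF crit, of "g * norm (F x)"] g by (simp add: d xh_def[symmetric])
  finally have "(g * \<mu>) * (g * (norm (F x))\<^sup>2) \<le> A * (g * (norm (F x))\<^sup>2)"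
    by (simp add: power2_eq_square algebra_simps)
  moreover have "0 < g * (norm (F x))\<^sup>2"
    using g nz by simp
  ultimately show ?thesis
    by (simp only: mult_le_cancel_right_pos)
qed

section \<open>One iteration\<close>

text \<open>
  Pythagoras for the projection of \<open>x\<close> onto the hyperplane \<open>{y. F xh \<bullet> (y - xh) = 0}\<close>, with the
  cross term left explicit.
\<close>
lemma polyak_step_distance:
  fixes F :: "'a::real_inner \<Rightarrow> 'a" and x xh z :: 'a
  assumes nz: "F xh \<noteq> 0"
  defines "w \<equiv> polyak_stepsize F x xh"
  shows "(norm (x - w *\<^sub>R F xh - z))\<^sup>2
         = (norm (x - z))\<^sup>2 - 2 * w * (F xh \<bullet> (xh - z)) - w\<^sup>2 * (norm (F xh))\<^sup>2"
proof -
  define b where "b = F xh"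
  have w: "w * (b \<bullet> b) = b \<bullet> (x - xh)"
    using nz by (simp add: w_def b_def polyak_stepsize_def power2_norm_eq_inner)
  have "(norm (x - w *\<^sub>R b - z))\<^sup>2 = (norm ((x - z) - w *\<^sub>R b))\<^sup>2"
    by (simp add: algebra_simps)
  also have "\<dots> = (norm (x - z))\<^sup>2 - 2 * w * (b \<bullet> (x - z)) + w * (w * (b \<bullet> b))"
    by (simp only: power2_norm_eq_inner) (simp add: inner_diff inner_commute algebra_simps)
  also have "b \<bullet> (x - z) = w * (b \<bullet> b) + b \<bullet> (xh - z)"
    by (simp add: w inner_diff)
  finally show ?thesis
    by (simp add: b_def power2_norm_eq_inner[of "F xh"] power2_eq_square[of w] algebra_simps)
qed

lemma polyak_stepsize_extrapolate:
  "polyak_stepsize F x (extrapolate F g x)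
     = g * (F x \<bullet> F (extrapolate F g x)) / (norm (F (extrapolate F g x)))\<^sup>2"
  by (simp add: polyak_stepsize_def extrapolate_def inner_commute)

lemma polyak_stepsize_ge:
  fixes F :: "'a::real_inner \<Rightarrow> 'a"
  assumes crit: "norm (F (extrapolate F g x) - F x) \<le> A * norm (F x)"
    and A: "0 \<le> A" "A \<le> 1" and g: "0 < g" and nz: "F (extrapolate F g x) \<noteq> 0"
  shows "g / (1 + A) \<le> polyak_stepsize F x (extrapolate F g x)"
proof -
  have "g * (norm (F (extrapolate F g x)))\<^sup>2 \<le> g * ((1 + A) * (F x \<bullet> F (extrapolate F g x)))"
    using critical_inner_ge_norm_sq[OF crit A] g by (intro mult_left_mono) auto
  then show ?thesis
    using A nz by (simp add: polyak_stepsize_extrapolate divide_simps mult_ac)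
qed

lemma polyak_displacement_ge:
  fixes F :: "'a::real_inner \<Rightarrow> 'a"
  assumes crit: "norm (F (extrapolate F g x) - F x) \<le> A * norm (F x)"
    and A: "0 \<le> A" "A \<le> 1" and nz: "F (extrapolate F g x) \<noteq> 0"
  defines "w \<equiv> polyak_stepsize F x (extrapolate F g x)"
  shows "(1 - A\<^sup>2) * (g\<^sup>2 * (norm (F x))\<^sup>2) \<le> w\<^sup>2 * (norm (F (extrapolate F g x)))\<^sup>2"
proof -
  define b where "b = F (extrapolate F g x)"
  have "w\<^sup>2 * (norm b)\<^sup>2 = g\<^sup>2 * ((F x \<bullet> b)\<^sup>2 / (norm b)\<^sup>2)"
    using nz by (simp add: w_def b_def polyak_stepsize_extrapolate power2_eq_square field_simps)
  moreover have "(1 - A\<^sup>2) * (norm (F x))\<^sup>2 \<le> (F x \<bullet> b)\<^sup>2 / (norm b)\<^sup>2"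
    using critical_inner_sq_ge[OF crit A] nz by (simp add: b_def pos_le_divide_eq)
  then have "g\<^sup>2 * ((1 - A\<^sup>2) * (norm (F x))\<^sup>2) \<le> g\<^sup>2 * ((F x \<bullet> b)\<^sup>2 / (norm b)\<^sup>2)"
    by (intro mult_left_mono) auto
  ultimately show ?thesis
    by (simp add: b_def mult_ac)
qed

lemma polyak_step_monotone:
  fixes F :: "'a::real_inner \<Rightarrow> 'a"
  assumes mono: "monotone_operator F" and zero: "F z = 0"
    and crit: "norm (F (extrapolate F g x) - F x) \<le> A * norm (F x)"
    and A: "0 \<le> A" "A \<le> 1" and g: "0 < g" and nz: "F (extrapolate F g x) \<noteq> 0"
  defines "xh \<equiv> extrapolate F g x"
  defines "w \<equiv> polyak_stepsize F x xh"
  shows "w\<^sup>2 * (norm (F xh))\<^sup>2 \<le> (norm (x - z))\<^sup>2 - (norm (x - w *\<^sub>R F xh - z))\<^sup>2"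
proof -
  have "0 \<le> g / (1 + A)"
    using A g by simp
  then have "0 \<le> w"
    using polyak_stepsize_ge[OF crit A g nz] by (simp add: w_def xh_def)
  moreover have "0 \<le> F xh \<bullet> (xh - z)"
    using mono zero unfolding monotone_operator_def by (metis diff_zero)
  ultimately have "0 \<le> w * (F xh \<bullet> (xh - z))"
    by simp
  then show ?thesis
    using polyak_step_distance[of F xh x z] nz by (simp add: xh_def w_def)
qed

lemma polyak_step_strongly_monotone:
  fixes F :: "'a::real_inner \<Rightarrow> 'a"
  assumes sm: "strongly_monotone_operator \<mu> F" and zero: "F z = 0"
    and crit: "norm (F (extrapolate F g x) - F x) \<le> A * norm (F x)"
    and A: "0 < A" "A < 1" and g: "0 < g" and nz: "F (extrapolate F g x) \<noteq> 0"
  defines "xh \<equiv> extrapolate F g x"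
  defines "w \<equiv> polyak_stepsize F x xh"
  shows "(norm (x - w *\<^sub>R F xh - z))\<^sup>2
         \<le> (1 - 2 * (1 - A) * g * \<mu> / (1 + A)\<^sup>2) * (norm (x - z))\<^sup>2"
proof -
  define h where "h = (norm (xh - z))\<^sup>2"
  define e where "e = g\<^sup>2 * (norm (F x))\<^sup>2"
  define c where "c = 2 * g * \<mu> / (1 + A)"
  define r where "r = (1 - A) / (1 + A)"
  have A': "0 \<le> A" "A \<le> 1"
    using A by auto
  have mu: "0 < \<mu>" and inner_ge: "\<mu> * h \<le> F xh \<bullet> (xh - z)"
    using sm zero unfolding strongly_monotone_operator_def h_def by (auto, metis diff_zero)
  have "F x \<noteq> 0"
    using crit nz by auto
  then have step: "g * \<mu> \<le> A"
    by (rule critical_step_bound[OF sm g _ crit])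
  have c0: "0 \<le> c" and r0: "0 < r" and e0: "0 \<le> e" and h0: "0 \<le> h"
    using A mu g by (auto simp: c_def r_def e_def h_def)
  have ww: "g / (1 + A) \<le> w"
    using polyak_stepsize_ge[OF crit A' g nz] by (simp add: w_def xh_def)
  \<comment> \<open>The weight of \<open>h\<close> is \<open>1 / r\<close> so that multiplying by \<open>c * r\<close> leaves \<open>c * h\<close>, which is
      all that the strong monotonicity term of the decrease provides.\<close>
  have young: "(norm (x - z))\<^sup>2 \<le> h / r + (1 + A) / (2 * A) * e"
  proof -
    define t where "t = 2 * A / (1 - A)"
    define u v where "u = xh - z" and "v = g *\<^sub>R F x"
    have t: "0 < t"
      using A by (simp add: t_def)
    have "0 \<le> (norm (t *\<^sub>R u - v))\<^sup>2"
      by simp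
    also have "(norm (t *\<^sub>R u - v))\<^sup>2 = t * (t * (u \<bullet> u) + v \<bullet> v / t - 2 * (u \<bullet> v))"
      using t by (simp only: power2_norm_eq_inner)
        (simp add: inner_diff inner_commute field_simps)
    finally have "2 * (u \<bullet> v) \<le> t * (u \<bullet> u) + v \<bullet> v / t"
      using t by (simp add: zero_le_mult_iff)
    then have "(norm (u + v))\<^sup>2 \<le> (1 + t) * (u \<bullet> u) + (1 + 1 / t) * (v \<bullet> v)"
      by (simp only: power2_norm_eq_inner) (simp add: inner_add inner_commute algebra_simps)
    moreover have "x - z = u + v"
      by (simp add: u_def v_def xh_def extrapolate_def)
    moreover have "1 + t = 1 / r" "1 + 1 / t = (1 + A) / (2 * A)"
      using A by (auto simp: t_def r_def field_simps)
    moreover have "u \<bullet> u = h" "v \<bullet> v = e"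
      by (simp_all add: u_def v_def h_def e_def power2_norm_eq_inner power2_eq_square[of g])
    ultimately show ?thesis
      by simp
  qed
  have "c * ((1 + A) / (2 * A)) = g * \<mu> / A"
    using A nonzero_mult_divide_mult_cancel_left[of "2 * (1 + A)" "g * \<mu>" A]
    by (simp add: c_def mult_ac)
  also have "\<dots> \<le> 1"
    using step A by simp
  also have "1 \<le> (1 + A)\<^sup>2"
    using A by simp
  finally have "r * (c * ((1 + A) / (2 * A))) \<le> r * (1 + A)\<^sup>2"
    using r0 by (intro mult_left_mono) auto
  also have "\<dots> = 1 - A\<^sup>2"
    using A by (simp add: r_def power2_eq_square field_simps)
  finally have coef: "r * (c * ((1 + A) / (2 * A))) * e \<le> (1 - A\<^sup>2) * e"
    using e0 by (rule mult_right_mono)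
  have "c * r * (norm (x - z))\<^sup>2 \<le> c * r * (h / r + (1 + A) / (2 * A) * e)"
    using young c0 r0 by (intro mult_left_mono) auto
  also have "\<dots> = c * h + r * (c * ((1 + A) / (2 * A))) * e"
    using r0 by (simp add: distrib_left mult_ac)
  also have "\<dots> \<le> c * h + (1 - A\<^sup>2) * e"
    using coef by simp
  also have "\<dots> \<le> 2 * w * (F xh \<bullet> (xh - z)) + w\<^sup>2 * (norm (F xh))\<^sup>2"
  proof (rule add_mono)
    have "c * h = 2 * (g / (1 + A)) * (\<mu> * h)"
      by (simp add: c_def)
    also have "\<dots> \<le> 2 * w * (F xh \<bullet> (xh - z))"
      using ww inner_ge g A mu h0 by (intro mult_mono) (auto intro: order_trans[OF _ ww])
    finally show "c * h \<le> 2 * w * (F xh \<bullet> (xh - z))" .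
    show "(1 - A\<^sup>2) * e \<le> w\<^sup>2 * (norm (F xh))\<^sup>2"
      using polyak_displacement_ge[OF crit A' nz] by (simp add: e_def w_def xh_def)
  qed
  also have "\<dots> = (norm (x - z))\<^sup>2 - (norm (x - w *\<^sub>R F xh - z))\<^sup>2"
    using polyak_step_distance[of F xh x z] nz by (simp add: xh_def w_def)
  finally have "(norm (x - w *\<^sub>R F xh - z))\<^sup>2 \<le> (1 - c * r) * (norm (x - z))\<^sup>2"
    by (simp add: left_diff_distrib)
  moreover have "c * r = 2 * (1 - A) * g * \<mu> / (1 + A)\<^sup>2"
    by (simp add: c_def r_def power2_eq_square)
  ultimately show ?thesis
    by simp
qed

text \<open>Nonnegativity lets the one-step bounds be multiplied along the iteration.\<close>
lemma contraction_factor_nonneg: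
  fixes A g \<mu> :: real
  assumes "0 \<le> A" "A \<le> 1" "g * \<mu> \<le> A"
  shows "0 \<le> 1 - 2 * (1 - A) * g * \<mu> / (1 + A)\<^sup>2"
proof -
  have "2 * (1 - A) * (g * \<mu>) \<le> 2 * (1 - A) * A"
    using assms by (intro mult_left_mono) auto
  also have "\<dots> \<le> (1 + A)\<^sup>2"
    using assms by (simp add: power2_eq_square algebra_simps)
  finally show ?thesis
    using assms by (simp add: divide_simps mult_ac)
qed

section \<open>Rates along the iteration\<close>

lemma Min_le_telescoping_average:
  fixes t d :: "nat \<Rightarrow> real"
  assumes dec: "\<And>k. k \<le> K \<Longrightarrow> t k \<le> C * (d k - d (Suc k))"
    and "0 \<le> C" "0 \<le> d (Suc K)"
  shows "(MIN k\<in>{0..K}. t k) \<le> C * d 0 / (real K + 1)"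
proof -
  have "(real K + 1) * (MIN k\<in>{0..K}. t k) = (\<Sum>j\<in>{0..K}. MIN k\<in>{0..K}. t k)"
    by simp
  also have "\<dots> \<le> (\<Sum>j\<in>{0..K}. t j)"
    by (intro sum_mono Min_le) auto
  also have "\<dots> \<le> (\<Sum>j\<in>{0..K}. C * (d j - d (Suc j)))"
    by (intro sum_mono dec) auto
  also have "\<dots> = C * (d 0 - d (Suc K))"
    by (simp add: sum_distrib_left[symmetric] atLeast0AtMost sum_telescope)
  also have "\<dots> \<le> C * d 0"
    using assms by (intro mult_left_mono) auto
  finally show ?thesis
    by (simp add: pos_le_divide_eq mult.commute)
qed

lemma le_prod_of_contraction:
  fixes q d :: "nat \<Rightarrow> real"
  assumes "\<And>j. j \<le> k \<Longrightarrow> d (Suc j) \<le> q j * d j" and "\<And>j. j \<le> k \<Longrightarrow> 0 \<le> q j"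
  shows "d (Suc k) \<le> (\<Prod>j=0..k. q j) * d 0"
  using assms
proof (induction k)
  case 0
  then show ?case by simp
next
  case (Suc k)
  have "d (Suc (Suc k)) \<le> q (Suc k) * d (Suc k)"
    using Suc.prems by simp
  also have "\<dots> \<le> q (Suc k) * ((\<Prod>j=0..k. q j) * d 0)"
    using Suc by (intro mult_left_mono) auto
  finally show ?case
    by (simp add: mult_ac)
qed

theorem theorem3p1:
  fixes F :: "real ^ 'd \<Rightarrow> real ^ 'd"
    and L A \<mu> :: real
    and \<gamma> :: "nat \<Rightarrow> real"
    and x0 xs :: "real ^ 'd"
    and x xh :: "nat \<Rightarrow> real ^ 'd"
  defines "x \<equiv> polyak_eg F \<gamma> x0"
    and "xh \<equiv> polyak_eg_hat F \<gamma> x0"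
  assumes lipschitz: "L-lipschitz_on UNIV F"
    and zero: "F xs = 0"
    and step_pos: "\<And>k. \<gamma> k > 0"
    and critical: "\<And>k. norm (F (xh k) - F (x k)) \<le> A * norm (F (x k))"
  shows
    "(monotone_operator F \<and> 0 < A \<and> A \<le> 1 \<longrightarrow>
       (\<forall>K. (\<forall>k\<le>K. F (xh k) \<noteq> 0) \<longrightarrow>
          (MIN k\<in>{0..K}. (\<gamma> k)\<^sup>2 * (norm (F (xh k)))\<^sup>2)
            \<le> (1 + A)\<^sup>2 * (norm (x0 - xs))\<^sup>2 / (real K + 1) \<and>
          (A < 1 \<longrightarrow>
            (MIN k\<in>{0..K}. (\<gamma> k)\<^sup>2 * (norm (F (x k)))\<^sup>2)
              \<le> (1 + A) * (norm (x0 - xs))\<^sup>2 / ((1 - A) * (real K + 1)))))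
     \<and>
     (strongly_monotone_operator \<mu> F \<and> 0 < A \<and> A < 1 \<longrightarrow>
       (\<forall>k. (\<forall>j\<le>k. F (xh j) \<noteq> 0) \<longrightarrow>
          (norm (x (Suc k) - xs))\<^sup>2
            \<le> (\<Prod>j=0..k. 1 - 2 * (1 - A) * \<gamma> j * \<mu> / (1 + A)\<^sup>2) * (norm (x0 - xs))\<^sup>2))"
proof -
  have xh: "xh k = extrapolate F (\<gamma> k) (x k)" for k
    by (simp add: xh_def x_def polyak_eg_hat_def)
  have x_Suc: "x (Suc k) = x k - polyak_stepsize F (x k) (xh k) *\<^sub>R F (xh k)" for k
    by (simp add: xh x_def Let_def)
  have x_0: "x 0 = x0"
    by (simp add: x_def)
  define d where "d k = (norm (x k - xs))\<^sup>2" for k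
  define w where "w k = polyak_stepsize F (x k) (xh k)" for k
  note crit = critical[unfolded xh]
  have part1: "(MIN k\<in>{0..K}. (\<gamma> k)\<^sup>2 * (norm (F (xh k)))\<^sup>2) \<le> (1 + A)\<^sup>2 * d 0 / (real K + 1) \<and>
      (A < 1 \<longrightarrow> (MIN k\<in>{0..K}. (\<gamma> k)\<^sup>2 * (norm (F (x k)))\<^sup>2)
                 \<le> (1 + A) / (1 - A) * d 0 / (real K + 1))"
    if mono: "monotone_operator F" and A: "0 < A" "A \<le> 1" and nz: "\<forall>k\<le>K. F (xh k) \<noteq> 0" for K
  proof (intro conjI impI; rule Min_le_telescoping_average)
    have decrease: "(w k)\<^sup>2 * (norm (F (xh k)))\<^sup>2 \<le> d k - d (Suc k)" if "k \<le> K" for k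
      using polyak_step_monotone[OF mono zero crit _ A(2) step_pos, of k] A nz that
      by (simp add: d_def w_def x_Suc xh)
    show "(\<gamma> k)\<^sup>2 * (norm (F (xh k)))\<^sup>2 \<le> (1 + A)\<^sup>2 * (d k - d (Suc k))" if "k \<le> K" for k
    proof -
      have "\<gamma> k / (1 + A) \<le> w k"
        using polyak_stepsize_ge[OF crit _ A(2) step_pos, of k] A nz that
        by (simp add: w_def xh)
      then have "\<gamma> k \<le> (1 + A) * w k"
        using A by (simp add: pos_divide_le_eq mult.commute)
      then have "(\<gamma> k)\<^sup>2 \<le> ((1 + A) * w k)\<^sup>2"
        using step_pos[of k] by (intro power_mono) auto
      then have "(\<gamma> k)\<^sup>2 * (norm (F (xh k)))\<^sup>2 \<le> ((1 + A) * w k)\<^sup>2 * (norm (F (xh k)))\<^sup>2"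
        by (rule mult_right_mono) simp
      also have "\<dots> = (1 + A)\<^sup>2 * ((w k)\<^sup>2 * (norm (F (xh k)))\<^sup>2)"
        by (simp add: power_mult_distrib)
      also have "\<dots> \<le> (1 + A)\<^sup>2 * (d k - d (Suc k))"
        using decrease[OF that] by (rule mult_left_mono) simp
      finally show ?thesis .
    qed
    show "(\<gamma> k)\<^sup>2 * (norm (F (x k)))\<^sup>2 \<le> (1 + A) / (1 - A) * (d k - d (Suc k))"
      if "A < 1" "k \<le> K" for k
    proof -
      define e where "e = (\<gamma> k)\<^sup>2 * (norm (F (x k)))\<^sup>2"
      \<comment> \<open>The claim is weaker than what the iteration yields: \<open>(1 - A) / (1 + A) \<le> 1 - A\<^sup>2\<close>.\<close>
      have "(1 - A) * 1 \<le> (1 - A) * (1 + A) * (1 + A)"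
        using A by (simp only: mult.assoc) (intro mult_left_mono, auto simp: algebra_simps)
      then have "(1 - A) * 1 * e \<le> (1 - A) * (1 + A) * (1 + A) * e"
        by (rule mult_right_mono) (simp add: e_def)
      also have "\<dots> = (1 + A) * ((1 - A\<^sup>2) * e)"
        by (simp add: power2_eq_square algebra_simps)
      also have "\<dots> \<le> (1 + A) * (d k - d (Suc k))"
      proof (rule mult_left_mono)
        have "(1 - A\<^sup>2) * e \<le> (w k)\<^sup>2 * (norm (F (xh k)))\<^sup>2"
          using polyak_displacement_ge[OF crit _ A(2), of k] A nz that
          by (simp add: w_def xh e_def)
        then show "(1 - A\<^sup>2) * e \<le> d k - d (Suc k)"
          using decrease[OF that(2)] by linarith
      qed (use A in simp)
      finally show ?thesis
        using that by (simp add: e_def field_simps)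
    qed
  qed (use A in \<open>auto simp: d_def\<close>)
  have part2: "d (Suc k) \<le> (\<Prod>j=0..k. 1 - 2 * (1 - A) * \<gamma> j * \<mu> / (1 + A)\<^sup>2) * d 0"
    if sm: "strongly_monotone_operator \<mu> F" and A: "0 < A" "A < 1" and nz: "\<forall>j\<le>k. F (xh j) \<noteq> 0" for k
  proof (rule le_prod_of_contraction)
    fix j assume j: "j \<le> k"
    show "d (Suc j) \<le> (1 - 2 * (1 - A) * \<gamma> j * \<mu> / (1 + A)\<^sup>2) * d j"
      using polyak_step_strongly_monotone[OF sm zero crit A step_pos, of j] nz j
      by (simp add: d_def x_Suc xh)
    have "F (x j) \<noteq> 0"
      using critical[of j] nz j by auto
    then show "0 \<le> 1 - 2 * (1 - A) * \<gamma> j * \<mu> / (1 + A)\<^sup>2"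
      using critical_step_bound[OF sm step_pos _ crit] A by (intro contraction_factor_nonneg) auto
  qed
  show ?thesis
    using part1 part2 by (simp add: d_def x_0)
qed

end
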